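(* The edge generating series of the Grand Motzkin lattices is $$\sum_{n\ge0}\ell(\mathcal{GM}_n)x^n=\frac{2x^2}{(1-3x)\sqrt{1-2x-3x^2}}.$$ Moreover, for every $n\ge0$: $$\ell(\mathcal{GM}_{n+2})=2\sum_{k=0}^nT_k\,3^{n-k}=\frac{2}{4^n}\sum_{k=0}^n\binom{2k}{k}\binom{2n-2k}{n-k}(2k+1)3^k(-1)^{n-k}=2\sum_{k=0}^n\binom{n+1}{k+1}\binom{2k}{k}(-1)^k3^{n-k}.$$ Finally, $\ell(\mathcal{GM}_n)\sim 2\cdot3^{n-2}\sqrt{3n/\pi}$ and $i(\mathcal{GM}_n)\sim\frac49 n$.
   Context: Steps: $U=(1,1)$, $D=(1,-1)$, $H=(1,0)$. $\mathcal{GM}_n$ is the set of all lattice paths from $(0,0)$ to $(n,0)$ with steps $U,D,H$, partially ordered by $\gamma_1\le\gamma_2$ iff $\gamma_1$ lies weakly below $\gamma_2$. $\ell(P)$ is the number of edges (covering pairs) of the Hasse diagram of a finite poset $P$ and $i(P)=\ell(P)/|P|$. $T_k=[x^k](1+x+x^2)^k$ is the central trinomial coefficient (so $|\mathcal{GM}_n|=T_n$). $a_n\sim b_n$ means $a_n/b_n\to1$. *)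

theory Defs
  imports "HOL-Analysis.Analysis" "HOL-Library.Landau_Symbols"
    "HOL-Computational_Algebra.Polynomial"
begin

text \<open>A path is encoded by its list of step heights: U = 1, H = 0, D = -1.\<close>
definition GM :: "nat \<Rightarrow> int list set" where
  "GM n = {p. length p = n \<and> set p \<subseteq> {-1, 0, 1} \<and> sum_list p = 0}"

definition below :: "int list \<Rightarrow> int list \<Rightarrow> bool" where
  "below p q \<longleftrightarrow> (\<forall>i \<le> length p. sum_list (take i p) \<le> sum_list (take i q))"

definition covers :: "'a set \<Rightarrow> ('a \<Rightarrow> 'a \<Rightarrow> bool) \<Rightarrow> 'a \<Rightarrow> 'a \<Rightarrow> bool" where
  "covers S le a b \<longleftrightarrow> a \<in> S \<and> b \<in> S \<and> le a b \<and> a \<noteq> b \<and>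
     \<not> (\<exists>c\<in>S. le a c \<and> le c b \<and> c \<noteq> a \<and> c \<noteq> b)"

definition hasse_edges :: "'a set \<Rightarrow> ('a \<Rightarrow> 'a \<Rightarrow> bool) \<Rightarrow> nat" where
  "hasse_edges S le = card {(a, b). covers S le a b}"

definition ell_GM :: "nat \<Rightarrow> nat" where
  "ell_GM n = hasse_edges (GM n) below"

definition i_GM :: "nat \<Rightarrow> real" where
  "i_GM n = real (ell_GM n) / real (card (GM n))"

definition T :: "nat \<Rightarrow> nat" where
  "T k = coeff ([:1, 1, 1:] ^ k) k"

end

theory Submission
  imports Defs "HOL-Real_Asymp.Real_Asymp"
begin

text \<open>
  A covering step in a Grand Motzkin lattice raises one interior point of the path, replacing
  consecutive steps \<open>(a, b)\<close>, \<open>a \<le> 0 \<le> b\<close>, by \<open>(a + 1, b - 1)\<close>. The four possible pairs \<open>(a, b)\<close>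
  have sums -1, 0, 0, 1, so counting the remaining steps gives
  \<open>ell_GM (n + 2) = (n + 1) (T n + T (n + 1))\<close>. By the three-term recurrence of \<open>T\<close>, which comes
  from \<open>P (P^n)' = n P' P^n\<close> for \<open>P = 1 + x + x^2\<close>, this equals \<open>2 \<Sum>k\<le>n. T k 3^(n-k)\<close>. The same
  recurrence identifies \<open>\<Sum>n. T n x^n\<close> with \<open>(1 - 3x)^(-1/2) (1 + x)^(-1/2)\<close>; convolving its two
  factors yields the series of \<open>ell_GM\<close> and the formula with two central binomials, and Tannery's
  theorem applied to the convolution gives the asymptotics of \<open>T\<close>. The last formula comes from
  \<open>P = (1 - x)^2 + 3x\<close>.
\<close>

section \<open>Covering pairs of Grand Motzkin paths\<close>

text \<open>The index names the step before the raised point, so the height that changes is the one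
  at \<open>Suc i\<close>.\<close>

definition raise :: "nat \<Rightarrow> int list \<Rightarrow> int list" where
  "raise i p = p[i := p ! i + 1, Suc i := p ! Suc i - 1]"

text \<open>A free end height is needed because deleting the two steps around a raised point can
  leave a path ending at -1 or 1.\<close>

definition paths_to :: "nat \<Rightarrow> int \<Rightarrow> int list set" where
  "paths_to n s = {p. length p = n \<and> set p \<subseteq> {-1, 0, 1} \<and> sum_list p = s}"

lemma GM_eq_paths_to: "GM n = paths_to n 0"
  by (simp add: GM_def paths_to_def)

lemma finite_paths_to [simp]: "finite (paths_to n s)"
  by (rule finite_subset[OF _ finite_lists_length_eq[of "{-1, 0, 1 :: int}" n]])
     (auto simp: paths_to_def)

lemma finite_GM [simp]: "finite (GM n)"
  by (simp add: GM_eq_paths_to)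

lemma nth_GM:
  assumes "p \<in> GM n" "k < n"
  shows "p ! k \<in> {-1, 0, 1}"
proof -
  have "p ! k \<in> set p" and "set p \<subseteq> {-1, 0, 1}"
    using assms by (auto simp: GM_def)
  then show ?thesis by blast
qed

lemma height_Suc:
  fixes p :: "int list"
  shows "k < length p \<Longrightarrow> sum_list (take (Suc k) p) = sum_list (take k p) + p ! k"
  by (simp add: take_Suc_conv_app_nth)

lemma height_inject:
  fixes p q :: "int list"
  assumes "length p = length q"
    and "\<And>k. k \<le> length p \<Longrightarrow> sum_list (take k p) = sum_list (take k q)"
  shows "p = q"
proof (rule nth_equalityI)
  fix k assume "k < length p"
  then show "p ! k = q ! k"
    using assms(2)[of k] assms(2)[of "Suc k"] assms(1) height_Suc[of k p] height_Suc[of k q]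
    by simp
qed fact

text \<open>The two changes +1 and -1 cancel in every prefix that contains both steps. Prefixes
  longer than the path are harmless, since \<open>take\<close> is then constant.\<close>

lemma height_raise:
  assumes "Suc i < length p"
  shows "sum_list (take k (raise i p)) = sum_list (take k p) + (if k = Suc i then 1 else 0)"
proof (induction k)
  case (Suc k)
  show ?case
  proof (cases "k < length p")
    case True
    with assms have "raise i p ! k = p ! k + (if k = i then 1 else if k = Suc i then -1 else 0)"
      by (simp add: raise_def nth_list_update)
    with True Suc show ?thesis
      by (simp add: height_Suc raise_def)
  next
    case False
    with Suc assms show ?thesis by (simp add: raise_def)
  qed
qed simp

lemma raise_in_GM:
  assumes "p \<in> GM n" "Suc i < n" "p ! i \<le> 0" "0 \<le> p ! Suc i"
  shows "raise i p \<in> GM n"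
proof -
  have len: "length p = n" and "sum_list p = 0"
    using assms(1) by (auto simp: GM_def)
  note vals = nth_GM[OF assms(1)]
  have "raise i p ! k \<in> {-1, 0, 1}" if "k < n" for k
    using that assms vals[of i] vals[of "Suc i"] vals[of k] len
    by (auto simp: raise_def nth_list_update)
  moreover have "sum_list (raise i p) = 0"
    using height_raise[of i p n] assms len \<open>sum_list p = 0\<close> by (simp add: raise_def)
  ultimately show ?thesis
    using len by (auto simp: GM_def raise_def in_set_conv_nth subset_iff)
qed

text \<open>The two paths differ by 1 at a single height, and heights are integers, so a path
  between them agrees with one of the two everywhere.\<close>

lemma covers_raise:
  assumes p: "p \<in> GM n" and i: "Suc i < n" and step: "p ! i \<le> 0" "0 \<le> p ! Suc i"
  shows "covers (GM n) below p (raise i p)"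
proof -
  have len: "length p = n" using p by (simp add: GM_def)
  note h = height_raise[of i p, unfolded len, OF i]
  have "raise i p \<noteq> p"
    using h[of "Suc i"] by auto
  moreover have "below p (raise i p)"
    by (simp add: below_def h)
  moreover have "c = p \<or> c = raise i p"
    if c: "c \<in> GM n" "below p c" "below c (raise i p)" for c
  proof -
    have lenc: "length c = n" using c(1) by (simp add: GM_def)
    have between: "sum_list (take k p) \<le> sum_list (take k c)"
      "sum_list (take k c) \<le> sum_list (take k p) + (if k = Suc i then 1 else 0)" if "k \<le> n" for k
      using c(2,3) that len lenc h[of k] by (auto simp: below_def)
    show ?thesis
    proof (cases "sum_list (take (Suc i) c) = sum_list (take (Suc i) p)")
      case True
      have "c = p"
      proof (rule height_inject)
        show "sum_list (take k c) = sum_list (take k p)" if "k \<le> length c" for k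
          using between[of k] that lenc True by (cases "k = Suc i") auto
      qed (simp add: len lenc)
      then show ?thesis ..
    next
      case False
      have "c = raise i p"
      proof (rule height_inject)
        show "sum_list (take k c) = sum_list (take k (raise i p))" if "k \<le> length c" for k
          using between[of k] that lenc False h[of k] by (cases "k = Suc i") auto
      qed (simp add: len lenc raise_def)
      then show ?thesis ..
    qed
  qed
  ultimately show ?thesis
    using p raise_in_GM[OF p i step] by (auto simp: covers_def)
qed

text \<open>Among the points where the lower path is strictly below the upper one, a lowest point
  can be raised without leaving the lattice.\<close>

lemma covers_imp_raise:
  assumes "covers (GM n) below p q"
  obtains i where "Suc i < n" "p ! i \<le> 0" "0 \<le> p ! Suc i" "q = raise i p"
proof -
  have p: "p \<in> GM n" and q: "q \<in> GM n" and pq: "below p q" and neq: "p \<noteq> q"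
    and no_mid: "\<And>c. c \<in> GM n \<Longrightarrow> below p c \<Longrightarrow> below c q \<Longrightarrow> c = p \<or> c = q"
    using assms by (auto simp: covers_def)
  have len: "length p = n" "length q = n" and tot: "sum_list p = 0" "sum_list q = 0"
    using p q by (auto simp: GM_def)
  note vals = nth_GM[OF p] nth_GM[OF q]
  define S where "S = {k. k \<le> n \<and> sum_list (take k p) < sum_list (take k q)}"
  have le: "sum_list (take k p) \<le> sum_list (take k q)" if "k \<le> n" for k
    using pq that len by (simp add: below_def)
  have eq: "sum_list (take k p) = sum_list (take k q)" if "k \<le> n" "k \<notin> S" for k
    using le[of k] that by (auto simp: S_def)
  have "S \<noteq> {}"
    using height_inject[of p q] neq eq len by auto
  moreover have "finite S" by (simp add: S_def)
  ultimately obtain k where k: "k \<in> S"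
    and min: "\<And>j. j \<in> S \<Longrightarrow> sum_list (take k p) \<le> sum_list (take j p)"
    using ex_is_arg_min_if_finite[of S "\<lambda>k. sum_list (take k p)"]
    by (auto simp: is_arg_min_linorder)
  \<comment> \<open>Both paths start and end at height 0, so they can differ only at interior
    points.\<close>
  have "k \<noteq> 0" "k \<noteq> n"
    by (rule notI, use k tot len in \<open>simp add: S_def\<close>)+
  then obtain i where i: "k = Suc i" and lt: "Suc i < n"
    using k by (cases k) (auto simp: S_def)
  have hp: "sum_list (take (Suc j) p) = sum_list (take j p) + p ! j"
    and hq: "sum_list (take (Suc j) q) = sum_list (take j q) + q ! j" if "j < n" for j
    using that len by (auto intro!: height_Suc)
  have ltk: "sum_list (take (Suc i) p) < sum_list (take (Suc i) q)"
    using k i by (simp add: S_def)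
  \<comment> \<open>If \<open>i\<close> is in \<open>S\<close>, minimality of the height at
    \<open>k\<close> excludes an up step. Otherwise the paths meet at \<open>i\<close> and separate
    at once, so \<open>p ! i < q ! i \<le> 1\<close>. The claim \<open>right\<close> is the mirror
    image.\<close>
  have left: "p ! i \<le> 0"
  proof (cases "i \<in> S")
    case True
    then show ?thesis using min[of i] hp[of i] lt i by simp
  next
    case False
    then show ?thesis using eq[of i] ltk hp[of i] hq[of i] vals[of i] lt by auto
  qed
  have right: "0 \<le> p ! Suc i"
  proof (cases "Suc (Suc i) \<in> S")
    case True
    then show ?thesis using min[of "Suc (Suc i)"] hp[of "Suc i"] lt i by simp
  next
    case False
    then show ?thesis
      using eq[of "Suc (Suc i)"] ltk hp[of "Suc i"] hq[of "Suc i"] vals[of "Suc i"] lt by auto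
  qed
  have c: "covers (GM n) below p (raise i p)"
    using p lt left right by (rule covers_raise)
  \<comment> \<open>By integrality the gap at \<open>Suc i\<close> is at least 1, which leaves room
    for the raised point.\<close>
  have "below (raise i p) q"
    using le ltk lt len by (simp add: below_def height_raise) (simp add: raise_def)
  then have "raise i p = q"
    using no_mid[of "raise i p"] c by (auto simp: covers_def)
  with that lt left right show thesis by blast
qed

lemma hasse_edges_GM:
  "{(p, q). covers (GM n) below p q} =
     (\<lambda>(i, p). (p, raise i p)) ` (SIGMA i:{..<n - 1}. {p \<in> GM n. p ! i \<le> 0 \<and> 0 \<le> p ! Suc i})"
proof (intro equalityI subsetI)
  fix e assume "e \<in> {(p, q). covers (GM n) below p q}"
  then obtain p q where e: "e = (p, q)" and c: "covers (GM n) below p q" by auto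
  then obtain i where "Suc i < n" "p ! i \<le> 0" "0 \<le> p ! Suc i" "q = raise i p"
    by (blast elim: covers_imp_raise)
  then show "e \<in> (\<lambda>(i, p). (p, raise i p)) ` 
      (SIGMA i:{..<n - 1}. {p \<in> GM n. p ! i \<le> 0 \<and> 0 \<le> p ! Suc i})"
    using e c by (auto simp: covers_def intro!: image_eqI[of _ _ "(i, p)"])
qed (auto intro!: covers_raise)

section \<open>Counting Hasse edges by the position of the raised point\<close>

lemma ell_GM_eq_sum:
  "ell_GM n = (\<Sum>i<n - 1. card {p \<in> GM n. p ! i \<le> 0 \<and> 0 \<le> p ! Suc i})"
proof -
  have "inj_on (\<lambda>(i, p). (p, raise i p))
      (SIGMA i:{..<n - 1}. {p \<in> GM n. p ! i \<le> 0 \<and> 0 \<le> p ! Suc i})"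
  proof (intro inj_onI, clarsimp)
    fix i j p assume "p \<in> GM n" and ij: "i < n - Suc 0" "j < n - Suc 0"
      and eq: "raise i p = raise j p"
    then have len: "length p = n" by (simp add: GM_def)
    \<comment> \<open>The only height at which the upper path exceeds \<open>p\<close> recovers the
      position.\<close>
    have "sum_list (take (Suc i) (raise i p)) = sum_list (take (Suc i) (raise j p))"
      by (simp only: eq)
    with ij len show "i = j"
      by (subst (asm) (1 2) height_raise) (auto split: if_splits)
  qed
  then show ?thesis
    by (simp add: ell_GM_def hasse_edges_def hasse_edges_GM card_image)
qed

text \<open>Cutting out the two steps around the raised point is a bijection onto pairs of steps
  together with a path of length \<open>m\<close> compensating their sum. The result does not depend
  on \<open>i\<close>, so every position contributes equally.\<close>

lemma card_raisable:
  assumes i: "i \<le> m"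
  shows "card {p \<in> GM (m + 2). p ! i \<le> 0 \<and> 0 \<le> p ! Suc i} =
           card (paths_to m (-1)) + 2 * card (paths_to m 0) + card (paths_to m 1)"
proof -
  define join :: "(int \<times> int) \<times> int list \<Rightarrow> int list"
    where "join x = take i (snd x) @ [fst (fst x), snd (fst x)] @ drop i (snd x)" for x
  let ?A = "SIGMA ab:{-1, 0} \<times> {0, 1}. paths_to m (- fst ab - snd ab)"
  have "bij_betw (\<lambda>p. ((p ! i, p ! Suc i), take i p @ drop (i + 2) p))
      {p \<in> GM (m + 2). p ! i \<le> 0 \<and> 0 \<le> p ! Suc i} ?A"
  proof (rule bij_betw_byWitness[where f' = join])
    have split: "take i p @ [p ! i, p ! Suc i] @ drop (i + 2) p = p"
      if "length p = m + 2" for p :: "int list"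
      using that i by (simp add: Cons_nth_drop_Suc)
    then show "\<forall>p \<in> {p \<in> GM (m + 2). p ! i \<le> 0 \<and> 0 \<le> p ! Suc i}.
        join ((p ! i, p ! Suc i), take i p @ drop (i + 2) p) = p"
      using i by (simp add: GM_def join_def)
    show "(\<lambda>p. ((p ! i, p ! Suc i), take i p @ drop (i + 2) p)) `
        {p \<in> GM (m + 2). p ! i \<le> 0 \<and> 0 \<le> p ! Suc i} \<subseteq> ?A"
    proof (rule image_subsetI)
      fix p assume p: "p \<in> {p \<in> GM (m + 2). p ! i \<le> 0 \<and> 0 \<le> p ! Suc i}"
      then have len: "length p = m + 2" by (simp add: GM_def)
      have "sum_list (take i p @ [p ! i, p ! Suc i] @ drop (i + 2) p) = 0"
        using p by (subst split[OF len]) (simp add: GM_def)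
      moreover have "p ! i \<in> {-1, 0, 1}" "p ! Suc i \<in> {-1, 0, 1}"
        using p i nth_GM[of p "m + 2" i] nth_GM[of p "m + 2" "Suc i"] by auto
      moreover have "set (take i p @ drop (i + 2) p) \<subseteq> {-1, 0, 1}"
        using p set_take_subset[of i p] set_drop_subset[of "i + 2" p] by (auto simp: GM_def)
      ultimately show "((p ! i, p ! Suc i), take i p @ drop (i + 2) p) \<in> ?A"
        using p i len by (auto simp: paths_to_def)
    qed
    show "join ` ?A
        \<subseteq> {p \<in> GM (m + 2). p ! i \<le> 0 \<and> 0 \<le> p ! Suc i}"
    proof (rule image_subsetI)
      fix x assume "x \<in> ?A"
      then obtain a b r where x: "x = ((a, b), r)" and ab: "a \<in> {-1, 0}" "b \<in> {0, 1}"
        and r: "r \<in> paths_to m (- a - b)"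
        by auto
      have "sum_list (take i r) + sum_list (drop i r) = sum_list r"
        by (metis append_take_drop_id sum_list_append)
      then show "join x \<in> {p \<in> GM (m + 2). p ! i \<le> 0 \<and> 0 \<le> p ! Suc i}"
        using r ab i x set_take_subset[of i r] set_drop_subset[of i r]
        by (auto simp: GM_def paths_to_def nth_append join_def)
    qed
  qed (use i in \<open>auto simp: paths_to_def nth_append join_def\<close>)
  then have "card {p \<in> GM (m + 2). p ! i \<le> 0 \<and> 0 \<le> p ! Suc i} = card ?A"
    by (rule bij_betw_same_card)
  also have "\<dots> = (\<Sum>ab\<in>{-1, 0} \<times> {0, 1}. card (paths_to m (- fst ab - snd ab)))"
    by simp
  also have "\<dots> = card (paths_to m (-1)) + 2 * card (paths_to m 0) + card (paths_to m 1)"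
    by (simp add: sum.cartesian_product[symmetric])
  finally show ?thesis .
qed

section \<open>Path counts as coefficients of powers of 1 + x + x^2\<close>

lemma card_paths_to_Suc:
  "card (paths_to (Suc n) s) =
     card (paths_to n (s + 1)) + card (paths_to n s) + card (paths_to n (s - 1))"
proof -
  have "paths_to (Suc n) s = (\<lambda>(a, r). a # r) ` (SIGMA a:{-1, 0, 1}. paths_to n (s - a))"
    by (auto simp: paths_to_def length_Suc_conv image_iff)
  moreover have "inj_on (\<lambda>(a, r). a # r) (SIGMA a:{-1, 0, 1}. paths_to n (s - a))"
    by (auto simp: inj_on_def)
  ultimately show ?thesis
    by (simp add: card_image)
qed

lemma paths_to_eq_empty:
  assumes "\<bar>s\<bar> > int n"
  shows "paths_to n s = {}"
proof -
  have "\<bar>sum_list p\<bar> \<le> int (length p)" if "set p \<subseteq> {-1, 0, 1}" for p :: "int list"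
    using that by (induction p) auto
  with assms show ?thesis by (force simp: paths_to_def)
qed

lemma coeff_trinomial_mult:
  "coeff ([:1, 1, 1:] * p) j =
     coeff p j + (if 1 \<le> j then coeff p (j - 1) else 0) + (if 2 \<le> j then coeff p (j - 2) else 0)"
  for p :: "'a::comm_semiring_1 poly"
  by (auto simp: coeff_pCons add.assoc split: nat.splits)

text \<open>Adding 1 to each step turns -1, 0, 1 into the exponents 0, 1, 2, so the exponent
  \<open>j\<close> corresponds to the end height \<open>j - n\<close>. The coefficient ring is left
  open because nat, int and real are all used later.\<close>

lemma coeff_trinomial_power:
  "coeff ([:1, 1, 1:] ^ n) j = (of_nat (card (paths_to n (int j - int n))) :: 'a::comm_semiring_1)"
proof (induction n arbitrary: j)
  case 0
  have "paths_to 0 (int j) = (if j = 0 then {[]} else {})"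
    by (auto simp: paths_to_def)
  then show ?case by simp
next
  case (Suc n)
  \<comment> \<open>Where natural subtraction would truncate, the integer end height lies below
    \<open>- n\<close> and is out of reach, so the count is 0; likewise in the next fact.\<close>
  have 1: "card (paths_to n (int j - int n - 1)) =
      (if 1 \<le> j then card (paths_to n (int (j - 1) - int n)) else 0)"
    using paths_to_eq_empty[of n "int j - int n - 1"] by (auto simp: algebra_simps)
  have 2: "card (paths_to n (int j - int n - 2)) =
      (if 2 \<le> j then card (paths_to n (int (j - 2) - int n)) else 0)"
    using paths_to_eq_empty[of n "int j - int n - 2"] by (auto simp: algebra_simps)
  have "coeff ([:1, 1, 1:] ^ Suc n) j = (of_nat (card (paths_to n (int j - int n))
      + card (paths_to n (int j - int n - 1)) + card (paths_to n (int j - int n - 2))) :: 'a)"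
    by (simp only: power_Suc coeff_trinomial_mult Suc 1 2 of_nat_add if_distrib[of of_nat] of_nat_0)
  also have "\<dots> = of_nat (card (paths_to (Suc n) (int j - int n - 1)))"
    by (simp add: card_paths_to_Suc)
  finally show ?case by (simp add: algebra_simps)
qed

lemma card_GM: "card (GM n) = T n"
  using coeff_trinomial_power[of n n, where 'a = nat]
  by (simp only: T_def GM_eq_paths_to diff_self of_nat_id)

lemma of_nat_T: "of_nat (T n) = (coeff ([:1, 1, 1:] ^ n) n :: 'a::comm_semiring_1)"
  by (simp only: coeff_trinomial_power card_GM[symmetric] GM_eq_paths_to diff_self)

text \<open>Of the four path counts at each of the \<open>n + 1\<close> positions, those ending at
  -1, 0, 1 add up to \<open>T (n + 1)\<close> by splitting off the first step; the second count for
  0 is \<open>T n\<close>.\<close>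

lemma ell_GM_eq_T: "ell_GM (n + 2) = (n + 1) * (T n + T (n + 1))"
proof -
  have "ell_GM (n + 2) = (\<Sum>i<n + 1. card (paths_to n (-1)) + 2 * card (paths_to n 0) + card (paths_to n 1))"
    by (subst ell_GM_eq_sum, rule sum.cong) (use card_raisable in auto)
  then show ?thesis
    by (simp add: card_GM[symmetric] GM_eq_paths_to card_paths_to_Suc)
qed

lemma ell_GM_0_1: "ell_GM 0 = 0" "ell_GM (Suc 0) = 0"
  by (simp_all add: ell_GM_eq_sum)

section \<open>Central trinomial coefficients\<close>

lemma coeff_trinomial_deriv_mult:
  "coeff ([:1, 2:] * p) j = coeff p j + (if 1 \<le> j then 2 * coeff p (j - 1) else 0)"
  for p :: "'a::comm_semiring_1 poly"
  by (auto simp: coeff_pCons split: nat.splits)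

lemma trinomial_power_pderiv:
  "[:1, 1, 1:] * pderiv ([:1, 1, 1:] ^ n) =
     smult (of_nat n) ([:1, 2:] * [:1, 1, 1 :: 'a::{idom,semiring_char_0}:] ^ n)"
proof (cases n)
  case (Suc m)
  have "pderiv [:1, 1, 1:] = ([:1, 2:] :: 'a poly)"
    by (simp add: pderiv_pCons)
  then show ?thesis
    unfolding Suc pderiv_power_Suc
    by (simp only: mult_smult_left mult_smult_right mult_ac power_Suc)
qed simp

text \<open>All quantities are expressed through the three coefficients \<open>t\<close>,
  \<open>u\<close>, \<open>v\<close> of the \<open>n\<close>-th power at \<open>n\<close>,
  \<open>n - 1\<close>, \<open>n - 2\<close>; the derivative identity supplies a linear relation
  that eliminates \<open>u\<close> and \<open>v\<close>.\<close>

lemma T_recurrence: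
  "(n + 2) * T (n + 2) = (2 * n + 3) * T (n + 1) + 3 * (n + 1) * T n"
proof -
  define c where "c m j = coeff ([:1, 1, 1 :: int:] ^ m) j" for m j
  have T: "int (T m) = c m m" for m
    by (simp only: of_nat_T c_def)
  have step: "c (Suc m) j = c m j + (if 1 \<le> j then c m (j - 1) else 0)
      + (if 2 \<le> j then c m (j - 2) else 0)" for m j
    unfolding c_def power_Suc by (rule coeff_trinomial_mult)
  have deriv: "int (Suc j) * c m (Suc j) + (if 1 \<le> j then int (Suc (j - 1)) * c m (Suc (j - 1)) else 0)
      + (if 2 \<le> j then int (Suc (j - 2)) * c m (Suc (j - 2)) else 0)
      = int m * (c m j + (if 1 \<le> j then 2 * c m (j - 1) else 0))" for m j
    using arg_cong[OF trinomial_power_pderiv[of m, where 'a = int], of "\<lambda>p. coeff p j"]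
    unfolding coeff_trinomial_mult coeff_smult coeff_trinomial_deriv_mult coeff_pderiv c_def .
  define t u v where "t = c n n" and "u = (if 1 \<le> n then c n (n - 1) else 0)"
    and "v = (if 2 \<le> n then c n (n - 2) else 0)"
  define t' where "t' = c (n + 1) (n + 1)"
  \<comment> \<open>This instance of the palindromic symmetry drops out of the derivative identity
    at the coefficient of x^m.\<close>
  have sym: "c m (Suc m) = (if 1 \<le> m then c m (m - 1) else 0)" for m
  proof -
    have "int (Suc m) * c m (Suc m) = int (Suc m) * (if 1 \<le> m then c m (m - 1) else 0)"
      using deriv[of m m] by (cases m; cases "m - 1") (simp_all add: algebra_simps)
    then show ?thesis by (simp only: mult_cancel_left) simp
  qed
  \<comment> \<open>For positive \<open>n\<close> this is the derivative identity for the
    \<open>n\<close>-th power at the coefficient of x^(n-1).\<close>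
  have "(int n + 2) * v = int n * t - u"
  proof (cases n)
    case 0
    then show ?thesis by (simp add: u_def v_def)
  next
    case (Suc m)
    then show ?thesis
      using deriv[of m n] unfolding t_def u_def v_def
      by (cases m; cases "m - 1") (simp_all add: algebra_simps)
  qed
  moreover have "t' = t + 2 * u"
    using sym[of n] unfolding t'_def t_def u_def by (simp add: step)
  moreover have "c (n + 2) (n + 2) = t' + 2 * (t + u + v)"
    using sym[of "n + 1"] unfolding t'_def t_def u_def v_def by (simp add: step)
  ultimately have "(int n + 2) * c (n + 2) (n + 2) = (2 * int n + 3) * t' + 3 * (int n + 1) * t"
    by algebra
  then have "int ((n + 2) * T (n + 2)) = int ((2 * n + 3) * T (n + 1) + 3 * (n + 1) * T n)"
    by (simp add: T t'_def t_def algebra_simps)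
  then show ?thesis by (simp only: of_nat_eq_iff)
qed

section \<open>Closed forms for sums of central trinomial coefficients weighted by powers of
  3\<close>

lemma sum_mult_power_Suc:
  fixes x :: "'a::comm_semiring_1"
  shows "(\<Sum>k\<le>Suc n. f k * x ^ (Suc n - k)) = f (Suc n) + x * (\<Sum>k\<le>n. f k * x ^ (n - k))"
  by (simp add: sum_distrib_left Suc_diff_le ac_simps)

text \<open>By \<open>T_recurrence\<close> both sides satisfy
  \<open>f (n + 1) = 2 * T (n + 1) + 3 * f n\<close>.\<close>

lemma sum_T_times_power_3: "2 * (\<Sum>k\<le>n. T k * 3 ^ (n - k)) = (n + 1) * (T n + T (n + 1))"
proof (induction n)
  case 0
  then show ?case by (simp add: T_def)
next
  case (Suc n)
  have "(\<Sum>k\<le>Suc n. T k * 3 ^ (Suc n - k)) = T (Suc n) + 3 * (\<Sum>k\<le>n. T k * 3 ^ (n - k))"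
    by (rule sum_mult_power_Suc)
  then have "2 * (\<Sum>k\<le>Suc n. T k * 3 ^ (Suc n - k)) = 2 * T (Suc n) + 3 * ((n + 1) * (T n + T (n + 1)))"
    using Suc by simp
  with T_recurrence[of n] show ?case
    by (simp add: algebra_simps)
qed

lemma Suc_times_central_binomial:
  "Suc k * (2 * Suc k choose Suc k) = 2 * (2 * k + 1) * (2 * k choose k)"
proof -
  have "Suc k * (2 * Suc k choose Suc k) = 2 * (Suc k * (Suc (2 * k) choose k))"
    using Suc_times_binomial[of k "Suc (2 * k)"] by simp
  also have "(Suc (2 * k) choose k) = (Suc (2 * k) choose Suc k)"
    using binomial_symmetric[of k "Suc (2 * k)"] by (simp add: Suc_diff_le)
  also have "Suc k * (Suc (2 * k) choose Suc k) = Suc (2 * k) * (2 * k choose k)"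
    by (rule Suc_times_binomial)
  finally show ?thesis by (simp only: mult.assoc Suc_eq_plus1)
qed

text \<open>In the binomial expansion of ((1 - x)^2 + 3x)^n the \<open>k\<close>-th term needs the
  coefficient of x^k in (1 - x)^(2k), a signed central binomial coefficient.\<close>

lemma T_eq_binomial_sum:
  "real (T n) = (\<Sum>k\<le>n. real (n choose k) * real (2 * k choose k) * (-1) ^ k * 3 ^ (n - k))"
proof -
  have "[:1, 1, 1:] = [:1, -1:] ^ 2 + ([:0, 3:] :: real poly)"
    by (simp add: power2_eq_square)
  then have "real (T n) = coeff (([:1, -1:] ^ 2 + monom 3 1) ^ n) n"
    by (simp add: of_nat_T monom_altdef)
  also have "\<dots> = (\<Sum>k\<le>n. real (n choose k) * (coeff ([:1, -1:] ^ (2 * k)) k * 3 ^ (n - k)))"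
    unfolding binomial_ring coeff_sum
  proof (rule sum.cong)
    fix k assume "k \<in> {..n}"
    then have "coeff (q * monom 3 1 ^ (n - k)) n = coeff q k * 3 ^ (n - k)" for q :: "real poly"
      by (simp add: monom_power coeff_monom_mult mult.commute[of q])
    then show "coeff (of_nat (n choose k) * ([:1, - 1:]\<^sup>2) ^ k * monom 3 1 ^ (n - k)) n =
         real (n choose k) * (coeff ([:1, - 1:] ^ (2 * k)) k * 3 ^ (n - k))"
      by (simp add: power_mult of_nat_poly)
  qed simp
  also have "\<dots> = (\<Sum>k\<le>n. real (n choose k) * real (2 * k choose k) * (-1) ^ k * 3 ^ (n - k))"
    by (intro sum.cong) (simp_all add: coeff_linear_poly_power)
  finally show ?thesis .
qed

text \<open>In the induction step Pascal's rule merges the binomial sum of \<open>T (Suc n)\<close>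
  with three times the previous sum.\<close>

lemma sum_T_eq_binomial_sum:
  "(\<Sum>k\<le>n. real (T k) * 3 ^ (n - k)) =
     (\<Sum>k\<le>n. real (Suc n choose Suc k) * real (2 * k choose k) * (-1) ^ k * 3 ^ (n - k))"
  (is "?S n = ?R n")
proof (induction n)
  case (Suc n)
  have "?S (Suc n) = real (T (Suc n)) + 3 * ?R n"
    by (simp only: sum_mult_power_Suc Suc)
  \<comment> \<open>The range may be extended to \<open>Suc n\<close> because the added binomial
    coefficient is 0.\<close>
  also have "3 * ?R n = (\<Sum>k\<le>Suc n. real (Suc n choose Suc k) * real (2 * k choose k) * (-1) ^ k * 3 ^ (Suc n - k))"
    by (simp only: sum_mult_power_Suc) (simp add: binomial_eq_0 del: binomial_Suc_Suc)
  also have "real (T (Suc n)) + \<dots> = ?R (Suc n)"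
    unfolding T_eq_binomial_sum sum.distrib[symmetric]
    by (intro sum.cong) (simp_all add: algebra_simps)
  finally show ?case .
qed (simp add: T_def)


section \<open>Generating functions\<close>

definition central :: "nat \<Rightarrow> real"
  where "central k = real (2 * k choose k)"

lemma central_0 [simp]: "central 0 = 1"
  by (simp add: central_def)

lemma central_Suc: "real (Suc k) * central (Suc k) = 2 * (2 * real k + 1) * central k"
  using arg_cong[OF Suc_times_central_binomial[of k], of real]
  unfolding central_def by (simp only: of_nat_mult of_nat_add of_nat_numeral of_nat_1)

text \<open>This is the first-order equation of (1 - 4cx)^(-1/2). The values c = 3/4 and c = -1/4
  give the factors (1 - 3x)^(-1/2) and (1 + x)^(-1/2).\<close>

lemma central_ODE:
  fixes c :: real
  defines "F \<equiv> Abs_fps (\<lambda>k. central k * c ^ k)"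
  shows "(1 - fps_const (4 * c) * fps_X) * fps_deriv F = fps_const (2 * c) * F"
proof (rule fps_ext)
  fix n
  show "fps_nth ((1 - fps_const (4 * c) * fps_X) * fps_deriv F) n = fps_nth (fps_const (2 * c) * F) n"
  proof (cases n)
    case 0
    then show ?thesis using central_Suc[of 0] by (simp add: F_def)
  next
    case (Suc m)
    then show ?thesis
      using central_Suc[of n]
      by (simp add: F_def algebra_simps)
  qed
qed

text \<open>The two first-order equations combine into one for the product, whose coefficients then
  obey the recurrence of \<open>T\<close>; the values at 0 and 1 agree.\<close>

lemma T_convolution:
  "real (T n) = (\<Sum>k\<le>n. (central k * (3/4) ^ k) * (central (n - k) * (-1/4) ^ (n - k)))"
proof -
  define F G where "F = Abs_fps (\<lambda>k. central k * (3/4) ^ k)"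
    and "G = Abs_fps (\<lambda>k. central k * (-1/4) ^ k)"
  define A where "A = F * G"
  have F: "(1 - fps_const 3 * fps_X) * fps_deriv F = fps_const (3/2) * F"
    using central_ODE[of "3/4"] by (simp add: F_def)
  have G: "(1 + fps_X) * fps_deriv G = fps_const (-1/2) * G"
  proof -
    have *: "1 - fps_const (4 * (-1/4)) * fps_X = (1 + fps_X :: real fps)"
      by (rule fps_ext) simp
    show ?thesis
      using central_ODE[of "-1/4"] unfolding * G_def by simp
  qed
  have "(1 - fps_const 3 * fps_X) * (1 + fps_X) * fps_deriv A =
      (1 + fps_X) * G * ((1 - fps_const 3 * fps_X) * fps_deriv F)
      + (1 - fps_const 3 * fps_X) * F * ((1 + fps_X) * fps_deriv G)"
    by (simp add: A_def algebra_simps)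
  also have "\<dots> = (fps_const (3/2) * (1 + fps_X) + fps_const (-1/2) * (1 - fps_const 3 * fps_X)) * A"
    unfolding F G A_def by (simp only: algebra_simps)
  also have "fps_const (3/2) * (1 + fps_X) + fps_const (-1/2) * (1 - fps_const 3 * fps_X) =
      1 + fps_const (3::real) * fps_X"
    by (rule fps_ext) (simp add: algebra_simps fps_X_def)
  finally have ODE: "(1 - fps_const 3 * fps_X) * (1 + fps_X) * fps_deriv A = (1 + fps_const 3 * fps_X) * A" .
  have rec: "real (n + 2) * fps_nth A (n + 2) =
      real (2 * n + 3) * fps_nth A (n + 1) + real (3 * (n + 1)) * fps_nth A n" for n
  proof -
    have "(1 - fps_const 3 * fps_X) * (1 + fps_X) * D =
        D - fps_const 2 * (fps_X * D) - fps_const 3 * (fps_X * (fps_X * D))" for D :: "real fps"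
      by (simp add: numeral_fps_const[symmetric] algebra_simps)
    moreover have "(1 + fps_const 3 * fps_X) * A = A + fps_const 3 * (fps_X * A)"
      by (simp only: distrib_right mult_1_left mult.assoc)
    ultimately have "fps_deriv A - fps_const 2 * (fps_X * fps_deriv A)
        - fps_const 3 * (fps_X * (fps_X * fps_deriv A)) = A + fps_const 3 * (fps_X * A)"
      using ODE by simp
    from arg_cong[OF this, of "\<lambda>f. fps_nth f (Suc n)"]
    have "real (n + 2) * fps_nth A (n + 2) - 2 * (real (n + 1) * fps_nth A (n + 1))
        - 3 * (real n * fps_nth A n) = fps_nth A (n + 1) + 3 * fps_nth A n"
      by (cases n) simp_all
    then show ?thesis
      by (simp add: algebra_simps)
  qed
  have "real (T n) = fps_nth A n"
  proof (induction n rule: less_induct)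
    case (less n)
    consider "n = 0" | "n = 1" | m where "n = m + 2"
      by (metis One_nat_def Suc_1 add_2_eq_Suc' not0_implies_Suc)
    then show ?case
    proof cases
      case 3
      have "real (m + 2) * real (T (m + 2)) =
          real (2 * m + 3) * real (T (m + 1)) + real (3 * (m + 1)) * real (T m)"
        using arg_cong[OF T_recurrence[of m], of real] by (simp only: of_nat_mult of_nat_add)
      also have "\<dots> = real (m + 2) * fps_nth A (m + 2)"
        unfolding rec using less[of m] less[of "m + 1"] 3 by simp
      finally show ?thesis
        unfolding 3 by (simp only: mult_cancel_left) simp
    qed (simp_all add: T_def A_def F_def G_def central_def)
  qed
  then show ?thesis
    by (simp add: A_def F_def G_def fps_mult_nth atMost_atLeast0)
qed

text \<open>Summation against powers of 3 multiplies the series by 1/(1 - 3x), which turns the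
  factor (1 - 3x)^(-1/2) into (1 - 3x)^(-3/2), here \<open>H\<close>.\<close>

lemma sum_T_convolution:
  "(\<Sum>k\<le>n. real (T k) * 3 ^ (n - k)) =
     (\<Sum>k\<le>n. ((2 * real k + 1) * central k * (3/4) ^ k) * (central (n - k) * (-1/4) ^ (n - k)))"
proof -
  define F G E H where "F = Abs_fps (\<lambda>k. central k * (3/4) ^ k)"
    and "G = Abs_fps (\<lambda>k. central k * (-1/4) ^ k)"
    and "E = Abs_fps (\<lambda>k. (3::real) ^ k)"
    and "H = Abs_fps (\<lambda>k. (2 * real k + 1) * central k * (3/4) ^ k)"
  have E: "(1 - fps_const 3 * fps_X) * E = 1"
    by (rule fps_ext) (auto simp: E_def left_diff_distrib mult.assoc power_eq_if)
  have F: "(1 - fps_const 3 * fps_X) * H = F"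
  proof (rule fps_ext)
    fix n
    show "fps_nth ((1 - fps_const 3 * fps_X) * H) n = fps_nth F n"
    proof (cases n)
      case (Suc m)
      then show ?thesis
        using arg_cong[OF central_Suc[of m], of "\<lambda>t. 12 * t * (3/4) ^ m"]
        by (simp add: H_def F_def algebra_simps)
    qed (simp add: H_def F_def)
  qed
  have "H = H * ((1 - fps_const 3 * fps_X) * E)"
    by (simp add: E)
  also have "\<dots> = F * E"
    by (simp add: F[symmetric] mult_ac)
  finally have "F * G * E = H * G"
    by (simp add: mult_ac)
  moreover have "F * G = Abs_fps (\<lambda>n. real (T n))"
    by (rule fps_ext) (simp add: T_convolution F_def G_def fps_mult_nth atMost_atLeast0)
  ultimately have "fps_nth (Abs_fps (\<lambda>n. real (T n)) * E) n = fps_nth (H * G) n"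
    by simp
  then show ?thesis
    by (simp add: E_def H_def G_def fps_mult_nth atMost_atLeast0)
qed

section \<open>Convergence of the generating series for real arguments\<close>

text \<open>Generalized binomial coefficients give access to the binomial series and, later, to the
  Gamma function asymptotics.\<close>

lemma central_eq_gbinomial: "central k = (-1/2 gchoose k) * (-4) ^ k"
proof (induction k)
  case (Suc k)
  have rec: "real (Suc k) * (-1/2 gchoose Suc k) = (-1/2 - real k) * (-1/2 gchoose k)"
    using gbinomial_mult_1[of "-1/2 :: real" k] by (simp add: algebra_simps)
  have "real (Suc k) * central (Suc k) = -4 * ((-1/2 - real k) * (-1/2 gchoose k)) * (-4) ^ k"
    unfolding central_Suc Suc by (simp add: algebra_simps)
  also have "\<dots> = real (Suc k) * ((-1/2 gchoose Suc k) * (-4) ^ Suc k)"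
    unfolding rec[symmetric] by simp
  finally have "real (Suc k) * central (Suc k) = \<dots>" .
  then show ?case by (simp only: mult_cancel_left) simp
qed simp

lemma odd_times_central_eq_gbinomial: "(2 * real k + 1) * central k = (-3/2 gchoose k) * (-4) ^ k"
  using gbinomial_absorb_comp[of "-1/2 :: real" k]
  by (simp add: central_eq_gbinomial algebra_simps)

lemma ell_GM_eq_sum_T: "real (ell_GM (n + 2)) = 2 * (\<Sum>k\<le>n. real (T k) * 3 ^ (n - k))"
  using arg_cong[OF sum_T_times_power_3[of n], of real] unfolding ell_GM_eq_T by simp

lemma sums_T_convolution:
  fixes x :: real
  assumes x: "\<bar>x\<bar> < 1/3"
  shows "(\<lambda>n. (\<Sum>k\<le>n. real (T k) * 3 ^ (n - k)) * x ^ n) sums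
           ((1 - 3 * x) powr (-3/2) * (1 + x) powr (-1/2))"
proof -
  define a b where "a k = (2 * real k + 1) * central k * (3/4) ^ k"
    and "b k = central k * (-1/4) ^ k" for k
  have a: "(\<lambda>k. a k * y ^ k) sums (1 - 3 * y) powr (-3/2)" if "\<bar>y\<bar> < 1/3" for y
  proof -
    have "a k * y ^ k = (-3/2 gchoose k) * (-3 * y) ^ k" for k
    proof -
      have "a k * y ^ k = (-3/2 gchoose k) * ((-4) ^ k * (3/4) ^ k * y ^ k)"
        by (simp add: a_def odd_times_central_eq_gbinomial)
      then show ?thesis by (simp flip: power_mult_distrib)
    qed
    then show ?thesis
      using gen_binomial_real[of "-3 * y" "-3/2"] that by simp
  qed
  have b: "(\<lambda>k. b k * y ^ k) sums (1 + y) powr (-1/2)" if "\<bar>y\<bar> < 1/3" for y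
  proof -
    have "b k = (-1/2 gchoose k)" for k
    proof -
      have "b k = (-1/2 gchoose k) * ((-4) ^ k * (-1/4) ^ k)"
        by (simp add: b_def central_eq_gbinomial)
      then show ?thesis by (simp flip: power_mult_distrib)
    qed
    then show ?thesis
      using gen_binomial_real[of y "-1/2"] that by simp
  qed
  \<comment> \<open>Convergence at a point strictly between |x| and 1/3 gives the absolute
    convergence at \<open>x\<close> that the Cauchy product requires.\<close>
  define r where "r = (\<bar>x\<bar> + 1/3) / 2"
  have r: "\<bar>r\<bar> < 1/3" "norm x < norm r"
    using x by (auto simp: r_def)
  have "(\<lambda>n. \<Sum>k\<le>n. (a k * x ^ k) * (b (n - k) * x ^ (n - k))) sums
      ((\<Sum>k. a k * x ^ k) * (\<Sum>k. b k * x ^ k))"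
    using powser_insidea[OF sums_summable[OF a[OF r(1)]] r(2)]
      powser_insidea[OF sums_summable[OF b[OF r(1)]] r(2)]
    by (rule Cauchy_product_sums)
  also have "(\<lambda>n. \<Sum>k\<le>n. (a k * x ^ k) * (b (n - k) * x ^ (n - k))) =
      (\<lambda>n. (\<Sum>k\<le>n. real (T k) * 3 ^ (n - k)) * x ^ n)"
  proof
    fix n
    have "(\<Sum>k\<le>n. real (T k) * 3 ^ (n - k)) * x ^ n = (\<Sum>k\<le>n. a k * b (n - k) * (x ^ k * x ^ (n - k)))"
      unfolding sum_T_convolution sum_distrib_right a_def b_def
      by (intro sum.cong) (simp_all flip: power_add)
    then show "(\<Sum>k\<le>n. (a k * x ^ k) * (b (n - k) * x ^ (n - k))) =
        (\<Sum>k\<le>n. real (T k) * 3 ^ (n - k)) * x ^ n"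
      by (simp add: mult_ac)
  qed
  finally show ?thesis
    using sums_unique[OF a[OF x]] sums_unique[OF b[OF x]] by simp
qed

lemma ell_GM_generating_function:
  fixes x :: real
  assumes x: "\<bar>x\<bar> < 1/3"
  shows "(\<lambda>n. real (ell_GM n) * x ^ n) sums (2 * x^2 / ((1 - 3*x) * sqrt (1 - 2*x - 3*x^2)))"
proof -
  have pos: "0 < 1 - 3 * x" "0 < 1 + x" using x by auto
  have "(1 - 3 * x) powr (-3/2) = 1 / ((1 - 3 * x) * sqrt (1 - 3 * x))"
    using pos powr_add[of "1 - 3 * x" 1 "1/2"] powr_minus_divide[of "1 - 3 * x" "3/2"]
    by (simp add: powr_half_sqrt)
  moreover have "(1 + x) powr (-1/2) = 1 / sqrt (1 + x)"
    using pos powr_minus_divide[of "1 + x" "1/2"] by (simp add: powr_half_sqrt)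
  moreover have "1 - 2 * x - 3 * x^2 = (1 - 3 * x) * (1 + x)"
    by (simp add: algebra_simps power2_eq_square)
  ultimately have "2 * x^2 * ((1 - 3 * x) powr (-3/2) * (1 + x) powr (-1/2)) =
      2 * x^2 / ((1 - 3*x) * sqrt (1 - 2*x - 3*x^2))"
    by (simp add: real_sqrt_mult)
  moreover have "(\<lambda>n. 2 * x^2 * ((\<Sum>k\<le>n. real (T k) * 3 ^ (n - k)) * x ^ n)) =
      (\<lambda>n. real (ell_GM (n + 2)) * x ^ (n + 2))"
    unfolding ell_GM_eq_sum_T by (simp add: power_add power2_eq_square mult_ac)
  ultimately have "(\<lambda>n. real (ell_GM (n + 2)) * x ^ (n + 2)) sums
      (2 * x^2 / ((1 - 3*x) * sqrt (1 - 2*x - 3*x^2)))"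
    using sums_mult[OF sums_T_convolution[OF x], of "2 * x^2"] by simp
  then show ?thesis
    by (subst (asm) sums_iff_shift) (simp add: ell_GM_0_1 numeral_2_eq_2 lessThan_Suc)
qed

section \<open>Asymptotics\<close>

text \<open>The probability that a simple random walk is back at its origin after 2k steps, of order
  1/sqrt k.\<close>

definition central_prob :: "nat \<Rightarrow> real"
  where "central_prob k = central k / 4 ^ k"

lemma central_prob_eq_gbinomial: "central_prob k = (-1/2 gchoose k) * (-1) ^ k"
  unfolding central_prob_def central_eq_gbinomial by (simp add: power_minus')

lemma central_prob_nonneg: "0 \<le> central_prob k"
  by (simp add: central_prob_def central_def)

lemma central_prob_Suc: "central_prob (Suc k) = central_prob k * (2 * real k + 1) / (2 * real k + 2)"
proof -
  have cancel: "2 * a * c / s / (4 * p) = c / p * a / (2 * s)" for a c s p :: real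
    by (cases "s = 0"; cases "p = 0") (simp_all add: field_simps)
  have rec: "central (Suc k) = 2 * (2 * real k + 1) * central k / real (Suc k)"
    using central_Suc[of k] by (simp only: eq_divide_eq) (simp add: mult.commute)
  have "2 * real k + 2 = 2 * real (Suc k)" by simp
  then show ?thesis
    by (simp only: central_prob_def power_Suc rec cancel)
qed

text \<open>A bound of order 1/sqrt k valid for all \<open>k\<close>, from which the majorant for
  Tannery's theorem is built.\<close>

lemma central_prob_bound: "(real k + 1) * (central_prob k)\<^sup>2 \<le> 1"
proof (induction k)
  case (Suc k)
  have "(real (Suc k) + 1) * (central_prob (Suc k))\<^sup>2 =
      ((real k + 1) * (central_prob k)\<^sup>2) *
      ((real k + 2) * (2 * real k + 1)\<^sup>2 / ((real k + 1) * (2 * real k + 2)\<^sup>2))"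
    by (simp add: central_prob_Suc power_divide power_mult_distrib add_pos_nonneg[THEN less_imp_neq, symmetric] mult_ac)
  also have "\<dots> \<le> 1 * 1"
  proof (rule mult_mono[OF Suc])
    have "(real k + 2) * (2 * real k + 1)\<^sup>2 \<le> (real k + 1) * (2 * real k + 2)\<^sup>2"
      by (simp add: power2_eq_square algebra_simps)
    then show "(real k + 2) * (2 * real k + 1)\<^sup>2 / ((real k + 1) * (2 * real k + 2)\<^sup>2) \<le> 1"
      by (simp add: divide_le_eq_1_pos)
  qed auto
  finally show ?case by simp
qed (simp add: central_prob_def)

lemma central_prob_limit: "(\<lambda>n. sqrt (real n) * central_prob n) \<longlonglongrightarrow> 1 / sqrt pi"
proof -
  have "(\<lambda>n. (-1/2 gchoose n) / ((-1)^n / exp ((-1/2 + 1) * of_real (ln (real n))))) \<longlonglongrightarrow> inverse (Gamma (- (-1/2)))"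
    by (rule gbinomial_asymptotic)
  also have "inverse (Gamma (- (-1/2))) = 1 / sqrt pi"
    by (simp add: Gamma_one_half_real inverse_eq_divide)
  finally have "(\<lambda>n. (-1/2 gchoose n) /
      ((-1)^n / exp ((-1/2 + 1) * of_real (ln (real n))))) \<longlonglongrightarrow> 1 / sqrt pi" .
  moreover have "\<forall>\<^sub>F n in sequentially.
      (-1/2 gchoose n) / ((-1)^n / exp ((-1/2 + 1) * of_real (ln (real n)))) = sqrt (real n) * central_prob n"
    using eventually_gt_at_top[of 0]
  proof eventually_elim
    case (elim n)
    then have e: "exp ((-1/2 + 1) * of_real (ln (real n))) = sqrt (real n)"
      using powr_half_sqrt[of "real n"] by (simp add: powr_def)
    show ?case
      unfolding e central_prob_eq_gbinomial by (cases "even n") simp_all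
  qed
  ultimately show ?thesis by (rule Lim_transform_eventually)
qed

text \<open>A fixed lag does not affect the limit, and the truncated subtraction concerns only
  finitely many \<open>n\<close>.\<close>

lemma central_prob_limit_shift: "(\<lambda>n. sqrt (real n) * central_prob (n - m)) \<longlonglongrightarrow> 1 / sqrt pi"
proof (rule LIMSEQ_offset[of _ m])
  have "(\<lambda>n. sqrt (real (n + m)) / sqrt (real n)) \<longlonglongrightarrow> 1"
    by real_asymp
  from tendsto_mult[OF this central_prob_limit]
  have "(\<lambda>n. sqrt (real (n + m)) / sqrt (real n) * (sqrt (real n) * central_prob n)) \<longlonglongrightarrow> 1 / sqrt pi"
    by simp
  moreover have "\<forall>\<^sub>F n in sequentially.
      sqrt (real (n + m)) / sqrt (real n) * (sqrt (real n) * central_prob n) =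
      sqrt (real (n + m)) * central_prob (n + m - m)"
    using eventually_gt_at_top[of 0] by eventually_elim simp
  ultimately show "(\<lambda>n. sqrt (real (n + m)) * central_prob (n + m - m)) \<longlonglongrightarrow> 1 / sqrt pi"
    by (rule Lim_transform_eventually)
qed

text \<open>The sum is reversed so that \<open>m\<close> indexes the geometrically decaying factor
  and the other factor has lag \<open>m\<close>.\<close>

lemma T_div_power_3:
  "real (T n) / 3 ^ n = (\<Sum>m\<le>n. central_prob (n - m) * (central_prob m * (-1/3) ^ m))"
proof -
  have "real (T n) / 3 ^ n = (\<Sum>k\<le>n. central_prob k * (central_prob (n - k) * (-1/3) ^ (n - k)))"
    unfolding T_convolution sum_divide_distrib
  proof (rule sum.cong)
    fix k assume "k \<in> {..n}"
    then have n: "(3::real) ^ n = 3 ^ k * 3 ^ (n - k)" by (simp flip: power_add)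
    have "(-1/4 :: real) ^ (n - k) = (-1/3 * (3/4)) ^ (n - k)"
      by simp
    also have "\<dots> = (-1/3) ^ (n - k) * (3/4) ^ (n - k)"
      by (rule power_mult_distrib)
    finally show "central k * (3/4) ^ k * (central (n - k) * (-1/4) ^ (n - k)) / 3 ^ n =
        central_prob k * (central_prob (n - k) * (-1/3) ^ (n - k))"
      by (simp only: n) (simp add: central_prob_def power_divide)
  qed simp
  also have "\<dots> = (\<Sum>m\<le>n. central_prob (n - m) * (central_prob m * (-1/3) ^ m))"
    unfolding atMost_atLeast0 by (subst sum.atLeastAtMost_rev) simp
  finally show ?thesis .
qed

text \<open>Taking limits term by term, the slowly decaying factor tends to 1/sqrt pi, and the rest
  sums to (1 + x)^(-1/2) at the singularity x = 1/3 of the other factor.\<close>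

lemma T_limit: "(\<lambda>n. sqrt (real n) * (real (T n) / 3 ^ n)) \<longlonglongrightarrow> sqrt 3 / (2 * sqrt pi)"
proof -
  define a where "a m n = (if m \<le> n then sqrt (real n) * central_prob (n - m) * (central_prob m * (-1/3) ^ m) else 0)"
    for m n :: nat
  define b where "b m = 1 / sqrt pi * (central_prob m * (-1/3) ^ m)" for m
  have "((\<lambda>n. a m n) \<longlongrightarrow> b m) sequentially" for m
  proof -
    have "(\<lambda>n. sqrt (real n) * central_prob (n - m) * (central_prob m * (-1/3) ^ m)) \<longlonglongrightarrow> b m"
      unfolding b_def by (intro tendsto_mult central_prob_limit_shift tendsto_const)
    moreover have "\<forall>\<^sub>F n in sequentially.
        sqrt (real n) * central_prob (n - m) * (central_prob m * (-1/3) ^ m) = a m n"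
      using eventually_ge_at_top[of m] by eventually_elim (simp add: a_def)
    ultimately show ?thesis by (rule Lim_transform_eventually)
  qed
  moreover have "norm (a m n) \<le> real (Suc m) * (1/3) ^ m" for m n
  proof (cases "m \<le> n")
    case True
    then obtain p where p: "n = m + p" using le_Suc_ex by blast
    have "(sqrt (real n) * central_prob (n - m))\<^sup>2 = real n * (central_prob (n - m))\<^sup>2"
      by (simp add: power_mult_distrib)
    \<comment> \<open>With \<open>n = m + p\<close> this is
      \<open>m + p \<le> (m + 1) * (p + 1)\<close>. The cruder bound by a square further on removes
      the root and leaves a majorant of the form of a differentiated geometric series.\<close>
    also have "\<dots> \<le> (real (Suc m) * (real (n - m) + 1)) * (central_prob (n - m))\<^sup>2"
      unfolding p by (intro mult_right_mono) (simp_all add: algebra_simps)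
    also have "\<dots> \<le> real (Suc m)"
      using mult_left_mono[OF central_prob_bound[of "n - m"], of "real (Suc m)"] by (simp only: mult.assoc) simp
    also have "\<dots> \<le> (real (Suc m))\<^sup>2"
      by (simp add: power2_eq_square)
    finally have 1: "sqrt (real n) * central_prob (n - m) \<le> real (Suc m)"
      by (rule power2_le_imp_le) simp
    have "(central_prob m)\<^sup>2 \<le> (real m + 1) * (central_prob m)\<^sup>2"
      by (simp add: mult_le_cancel_right1)
    then have "(central_prob m)\<^sup>2 \<le> 1\<^sup>2"
      using central_prob_bound[of m] by simp
    then have 2: "central_prob m \<le> 1"
      by (rule power2_le_imp_le) simp
    have "norm (a m n) = (sqrt (real n) * central_prob (n - m)) * (central_prob m * (1/3) ^ m)"
      using True by (simp add: a_def abs_mult power_abs central_prob_nonneg)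
    also have "\<dots> \<le> real (Suc m) * (1 * (1/3) ^ m)"
      by (intro mult_mono 1 2) (auto simp: central_prob_nonneg)
    finally show ?thesis by simp
  qed (simp add: a_def)
  moreover have "summable (\<lambda>m. real (Suc m) * (1/3) ^ m)"
    using geometric_deriv_sums[of "1/3 :: real"] by (simp add: sums_iff)
  ultimately have "(\<lambda>n. \<Sum>m. a m n) \<longlonglongrightarrow> (\<Sum>m. b m)"
    using tannerys_theorem[of a b sequentially "\<lambda>m. real (Suc m) * (1/3) ^ m"]
    by (simp add: always_eventually)
  moreover have "(\<Sum>m. a m n) = sqrt (real n) * (real (T n) / 3 ^ n)" for n
  proof -
    have "(\<Sum>m. a m n) = (\<Sum>m\<le>n. a m n)"
      by (rule suminf_finite) (auto simp: a_def)
    then show ?thesis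
      by (simp add: a_def T_div_power_3 sum_distrib_left mult_ac)
  qed
  moreover have "(\<Sum>m. b m) = sqrt 3 / (2 * sqrt pi)"
  proof -
    have b: "b m = 1 / sqrt pi * ((-1/2 gchoose m) * (1/3) ^ m)" for m
      by (cases "even m") (simp_all add: b_def central_prob_eq_gbinomial power_divide)
    have sums: "(\<lambda>m. 1 / sqrt pi * ((-1/2 gchoose m) * (1/3) ^ m)) sums (1 / sqrt pi * (1 + 1/3) powr (-1/2))"
      by (intro sums_mult gen_binomial_real) simp
    have val: "(1 + 1/3 :: real) powr (-1/2) = sqrt 3 / 2"
      using powr_minus_divide[of "4/3 :: real" "1/2"] by (simp add: powr_half_sqrt real_sqrt_divide)
    show ?thesis
      unfolding b sums_unique[OF sums, symmetric] val by simp
  qed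
  ultimately show ?thesis by simp
qed

lemma T_asymp_equiv: "(\<lambda>n. real (T n)) \<sim>[at_top] (\<lambda>n. sqrt 3 / (2 * sqrt pi) * (3 ^ n / sqrt (real n)))"
  by (rule asymp_equivI'_const) (use T_limit in \<open>simp_all add: mult_ac\<close>)

text \<open>In \<open>ell_GM_eq_T\<close> the terms \<open>T n\<close> and \<open>T (n + 1)\<close>
  contribute in the ratio 1 : 3, and the shift of the index by 2 divides by 9, giving 4/9 of the
  constant \<open>c\<close> of \<open>T\<close>.\<close>

lemma ell_GM_asymp_equiv:
  "(\<lambda>n. real (ell_GM n)) \<sim>[at_top] (\<lambda>n. 2 / 9 * sqrt (3 / pi) * (3 ^ n * sqrt (real n)))"
proof (rule asymp_equivI'_const, rule LIMSEQ_offset[of _ 2])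
  define c :: real where "c = sqrt 3 / (2 * sqrt pi)"
  define L where "L n = sqrt (real n) * (real (T n) / 3 ^ n)" for n
  have L: "L \<longlonglongrightarrow> c" "(\<lambda>n. L (n + 1)) \<longlonglongrightarrow> c"
    using T_limit LIMSEQ_ignore_initial_segment[OF T_limit, of 1]
    by (auto simp: L_def[abs_def] c_def)
  have "(\<lambda>n. (real n + 1) / (sqrt (real n + 2) * sqrt (real n))) \<longlonglongrightarrow> 1"
    "(\<lambda>n. (real n + 1) / (sqrt (real n + 2) * sqrt (real n + 1))) \<longlonglongrightarrow> 1"
    by real_asymp+
  then have "(\<lambda>n. 1/9 * ((real n + 1) / (sqrt (real n + 2) * sqrt (real n)) * L n +
      3 * ((real n + 1) / (sqrt (real n + 2) * sqrt (real n + 1)) * L (n + 1)))) \<longlonglongrightarrow> 1/9 * (1 * c + 3 * (1 * c))"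
    by (intro tendsto_intros L)
  also have "1/9 * (1 * c + 3 * (1 * c)) = 2 / 9 * sqrt (3 / pi)"
    by (simp add: c_def real_sqrt_divide)
  finally show "(\<lambda>n. real (ell_GM (n + 2)) / (3 ^ (n + 2) * sqrt (real (n + 2)))) \<longlonglongrightarrow> 2 / 9 * sqrt (3 / pi)"
  proof (rule Lim_transform_eventually)
    show "\<forall>\<^sub>F n in sequentially.
      1/9 * ((real n + 1) / (sqrt (real n + 2) * sqrt (real n)) * L n +
        3 * ((real n + 1) / (sqrt (real n + 2) * sqrt (real n + 1)) * L (n + 1))) =
      real (ell_GM (n + 2)) / (3 ^ (n + 2) * sqrt (real (n + 2)))"
      using eventually_gt_at_top[of 0]
    proof eventually_elim
      case (elim n)
      have "L n / sqrt (real n) = real (T n) / 3 ^ n"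
        using elim by (simp add: L_def)
      moreover have "L (n + 1) / sqrt (real n + 1) = real (T (n + 1)) / 3 ^ (n + 1)"
        by (simp add: L_def add.commute)
      moreover have "1/9 * ((real n + 1) / (sqrt (real n + 2) * sqrt (real n)) * L n +
          3 * ((real n + 1) / (sqrt (real n + 2) * sqrt (real n + 1)) * L (n + 1))) =
        1/9 * ((real n + 1) / sqrt (real n + 2)) *
          (L n / sqrt (real n) + 3 * (L (n + 1) / sqrt (real n + 1)))"
        by (simp only: divide_inverse inverse_mult_distrib distrib_left mult_ac)
      ultimately show ?case
        by (simp only: ell_GM_eq_T) (simp add: field_simps)
    qed
  qed
qed simp

theorem mainTheorem10:
  shows "(\<forall>x::real. \<bar>x\<bar> < 1/3 \<longrightarrow>
           (\<lambda>n. real (ell_GM n) * x ^ n) sums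
             (2 * x^2 / ((1 - 3*x) * sqrt (1 - 2*x - 3*x^2))))
    \<and> (\<forall>n. real (ell_GM (n+2)) = 2 * (\<Sum>k=0..n. real (T k) * 3^(n-k)))
    \<and> (\<forall>n. real (ell_GM (n+2)) = 2 / 4^n * (\<Sum>k=0..n. real ((2*k) choose k)
              * real ((2*n - 2*k) choose (n-k)) * (2 * real k + 1) * 3^k * (-1)^(n-k)))
    \<and> (\<forall>n. real (ell_GM (n+2)) = 2 * (\<Sum>k=0..n. real ((n+1) choose (k+1))
              * real ((2*k) choose k) * (-1)^k * 3^(n-k)))
    \<and> ((\<lambda>n. real (ell_GM n)) \<sim>[at_top] (\<lambda>n. 2 * 3 powr (real n - 2) * sqrt (3 * real n / pi)))
    \<and> (i_GM \<sim>[at_top] (\<lambda>n. 4/9 * real n))"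
proof (intro conjI allI impI)
  fix x :: real assume "\<bar>x\<bar> < 1/3"
  then show "(\<lambda>n. real (ell_GM n) * x ^ n) sums
      (2 * x^2 / ((1 - 3*x) * sqrt (1 - 2*x - 3*x^2)))"
    by (rule ell_GM_generating_function)
next
  fix n
  show "real (ell_GM (n+2)) = 2 * (\<Sum>k=0..n. real (T k) * 3^(n-k))"
    by (simp only: ell_GM_eq_sum_T atMost_atLeast0)
next
  fix n
  have "(\<Sum>k\<le>n. ((2 * real k + 1) * central k * (3/4) ^ k) * (central (n - k) * (-1/4) ^ (n - k))) =
      1 / 4^n * (\<Sum>k\<le>n. real ((2*k) choose k)
              * real ((2*n - 2*k) choose (n-k)) * (2 * real k + 1) * 3^k * (-1)^(n-k))"
    unfolding sum_distrib_left
  proof (rule sum.cong)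
    fix k assume "k \<in> {..n}"
    then have "(4::real) ^ n = 4 ^ k * 4 ^ (n - k)" by (simp flip: power_add)
    then show "(2 * real k + 1) * central k * (3/4) ^ k * (central (n - k) * (-1/4) ^ (n - k)) =
       1 / 4^n * (real ((2*k) choose k)
              * real ((2*n - 2*k) choose (n-k)) * (2 * real k + 1) * 3^k * (-1)^(n-k))"
      by (simp only: power_divide) (simp add: central_def diff_mult_distrib2)
  qed simp
  then show "real (ell_GM (n+2)) = 2 / 4^n * (\<Sum>k=0..n. real ((2*k) choose k)
              * real ((2*n - 2*k) choose (n-k)) * (2 * real k + 1) * 3^k * (-1)^(n-k))"
    unfolding ell_GM_eq_sum_T sum_T_convolution by (simp add: atMost_atLeast0)
next
  fix n
  show "real (ell_GM (n+2)) = 2 * (\<Sum>k=0..n. real ((n+1) choose (k+1))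
              * real ((2*k) choose k) * (-1)^k * 3^(n-k))"
    unfolding ell_GM_eq_sum_T sum_T_eq_binomial_sum by (simp only: atMost_atLeast0 Suc_eq_plus1)
next
  have "(\<lambda>n. 2 * 3 powr (real n - 2) * sqrt (3 * real n / pi)) =
      (\<lambda>n. 2 / 9 * sqrt (3 / pi) * (3 ^ n * sqrt (real n)))"
  proof
    fix n
    have "sqrt (3 * real n / pi) = sqrt (3 / pi) * sqrt (real n)"
      by (simp flip: real_sqrt_mult)
    moreover have "(3::real) powr (real n - 2) = 3 ^ n / 9"
      by (simp add: powr_diff powr_realpow)
    ultimately show "2 * 3 powr (real n - 2) * sqrt (3 * real n / pi) =
        2 / 9 * sqrt (3 / pi) * (3 ^ n * sqrt (real n))"
      by simp
  qed
  then show "(\<lambda>n. real (ell_GM n)) \<sim>[at_top] (\<lambda>n. 2 * 3 powr (real n - 2) * sqrt (3 * real n / pi))"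
    using ell_GM_asymp_equiv by simp
next
  have i: "i_GM = (\<lambda>n. real (ell_GM n) / real (T n))"
    by (simp add: i_GM_def card_GM fun_eq_iff)
  have "i_GM \<sim>[at_top] (\<lambda>n. 2 / 9 * sqrt (3 / pi) * (3 ^ n * sqrt (real n)) /
      (sqrt 3 / (2 * sqrt pi) * (3 ^ n / sqrt (real n))))"
    unfolding i by (intro asymp_equiv_divide ell_GM_asymp_equiv T_asymp_equiv)
  also have "\<dots> = (\<lambda>n. 4/9 * real n)"
  proof
    fix n
    \<comment> \<open>The case \<open>r = 0\<close> is \<open>n = 0\<close>, where division by zero
      makes both sides 0, so the two functions agree everywhere.\<close>
    have "2 / 9 * (s / p) * (q * r) / (s / (2 * p) * (q / r)) = 4/9 * (r * r)"
      if "s \<noteq> 0" "p \<noteq> 0" "q \<noteq> 0" for s p q r :: real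
      using that by (cases "r = 0") (simp_all add: field_simps)
    from this[of "sqrt 3" "sqrt pi" "3 ^ n" "sqrt (real n)"]
    show "2 / 9 * sqrt (3 / pi) * (3 ^ n * sqrt (real n)) /
        (sqrt 3 / (2 * sqrt pi) * (3 ^ n / sqrt (real n))) = 4/9 * real n"
      by (simp add: real_sqrt_divide)
  qed
  finally show "i_GM \<sim>[at_top] (\<lambda>n. 4/9 * real n)" .
qed

end
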